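(* Every twist $\Sigma$ over a $\sigma$-compact ample groupoid $G$ is continuous; that is, the quotient map $j:\Sigma\to G$ admits a (globally defined) continuous cross section.
   Context: Groupoids are locally compact Hausdorff topological groupoids, with unit space $G^{(0)}$, domain map $d(g)=g^{-1}g$ and range map $r(g)=gg^{-1}$. $G$ is étale if $d$ is a local homeomorphism, and ample if it is étale and $G^{(0)}$ is totally disconnected. A twist over $G$ is a central extension of (locally compact Hausdorff) topological groupoids $G^{(0)}\times\mathbb T\xrightarrow{i}\Sigma\xrightarrow{j}G$: $i,j$ are groupoid homomorphisms, $\Sigma^{(0)}$ is identified with $G^{(0)}$, $j(i(u,z))=u$, $i$ is a homeomorphism onto $j^{-1}(G^{(0)})\subseteq\Sigma$, $j$ is a continuous and open surjection, and $i(r(\sigma),z)\sigma=\sigma i(d(\sigma),z)$ for all $\sigma\in\Sigma$, $z\in\mathbb T$. The twist is called continuous if there is a continuous map $s:G\to\Sigma$ with $j\circ s=\mathrm{id}_G$. *)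

theory Defs
  imports "HOL-Analysis.Analysis"
begin

section \<open>Notions from general topology\<close>

definition local_homeomorphism_map :: "'a topology \<Rightarrow> 'b topology \<Rightarrow> ('a \<Rightarrow> 'b) \<Rightarrow> bool"
  where "local_homeomorphism_map X Y f \<longleftrightarrow>
    f \<in> topspace X \<rightarrow> topspace Y \<and>
    (\<forall>x\<in>topspace X. \<exists>U. openin X U \<and> x \<in> U \<and> openin Y (f ` U) \<and>
        homeomorphic_map (subtopology X U) (subtopology Y (f ` U)) f)"

definition totally_disconnected_space :: "'a topology \<Rightarrow> bool"
  where "totally_disconnected_space X \<longleftrightarrow> (\<forall>S. connectedin X S \<longrightarrow> (\<exists>x. S \<subseteq> {x}))"

definition sigma_compact_space :: "'a topology \<Rightarrow> bool"
  where "sigma_compact_space X \<longleftrightarrow>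
    (\<exists>\<K>. countable \<K> \<and> (\<forall>K\<in>\<K>. compactin X K) \<and> \<Union>\<K> = topspace X)"


section \<open>Topological groupoids\<close>

text \<open>
  A groupoid is given by its arrows, the topology on them (the set of arrows is its
  \<^const>\<open>topspace\<close>), the set of composable pairs, the partial product and the inversion. The values
  of \<open>gmult\<close> outside \<open>gpairs\<close> and of \<open>ginv\<close> outside the set of arrows are irrelevant.
\<close>

record 'a groupoid =
  gtop :: "'a topology"
  gpairs :: "('a \<times> 'a) set"
  gmult :: "'a \<Rightarrow> 'a \<Rightarrow> 'a"
  ginv :: "'a \<Rightarrow> 'a"

definition arrows :: "'a groupoid \<Rightarrow> 'a set"
  where "arrows G = topspace (gtop G)"

definition gdom :: "'a groupoid \<Rightarrow> 'a \<Rightarrow> 'a"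
  where "gdom G g = gmult G (ginv G g) g"

definition gran :: "'a groupoid \<Rightarrow> 'a \<Rightarrow> 'a"
  where "gran G g = gmult G g (ginv G g)"

definition units :: "'a groupoid \<Rightarrow> 'a set"
  where "units G = gdom G ` arrows G"

definition unit_top :: "'a groupoid \<Rightarrow> 'a topology"
  where "unit_top G = subtopology (gtop G) (units G)"

text \<open>
  The algebraic axioms are those of Hahn and Renault; they are equivalent to being a small category
  in which every arrow is invertible, and imply that \<open>(g, h)\<close> is composable iff
  \<open>gdom G g = gran G h\<close>.
\<close>

locale topological_groupoid =
  fixes G :: "'a groupoid"
  assumes gpairs_subset: "gpairs G \<subseteq> arrows G \<times> arrows G"
    and gmult_closed: "(g, h) \<in> gpairs G \<Longrightarrow> gmult G g h \<in> arrows G"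
    and ginv_closed: "g \<in> arrows G \<Longrightarrow> ginv G g \<in> arrows G"
    and ginv_ginv: "g \<in> arrows G \<Longrightarrow> ginv G (ginv G g) = g"
    and gpairs_mult_left:
      "\<lbrakk>(g, h) \<in> gpairs G; (h, k) \<in> gpairs G\<rbrakk> \<Longrightarrow> (gmult G g h, k) \<in> gpairs G"
    and gpairs_mult_right:
      "\<lbrakk>(g, h) \<in> gpairs G; (h, k) \<in> gpairs G\<rbrakk> \<Longrightarrow> (g, gmult G h k) \<in> gpairs G"
    and gmult_assoc:
      "\<lbrakk>(g, h) \<in> gpairs G; (h, k) \<in> gpairs G\<rbrakk>
        \<Longrightarrow> gmult G (gmult G g h) k = gmult G g (gmult G h k)"
    and gpairs_ginv: "g \<in> arrows G \<Longrightarrow> (ginv G g, g) \<in> gpairs G"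
    and ginv_cancel_left: "(g, h) \<in> gpairs G \<Longrightarrow> gmult G (ginv G g) (gmult G g h) = h"
    and ginv_cancel_right: "(g, h) \<in> gpairs G \<Longrightarrow> gmult G (gmult G g h) (ginv G h) = g"
    and continuous_gmult:
      "continuous_map (subtopology (prod_topology (gtop G) (gtop G)) (gpairs G)) (gtop G)
        (\<lambda>(g, h). gmult G g h)"
    and continuous_ginv: "continuous_map (gtop G) (gtop G) (ginv G)"

locale lch_groupoid = topological_groupoid +
  assumes locally_compact: "locally_compact_space (gtop G)"
    and Hausdorff: "Hausdorff_space (gtop G)"

locale etale_groupoid = lch_groupoid +
  assumes dom_local_homeomorphism: "local_homeomorphism_map (gtop G) (unit_top G) (gdom G)"

locale ample_groupoid = etale_groupoid +
  assumes units_totally_disconnected: "totally_disconnected_space (unit_top G)"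

definition groupoid_hom :: "'a groupoid \<Rightarrow> 'b groupoid \<Rightarrow> ('a \<Rightarrow> 'b) \<Rightarrow> bool"
  where "groupoid_hom G H f \<longleftrightarrow>
    f \<in> arrows G \<rightarrow> arrows H \<and>
    (\<forall>(g, h)\<in>gpairs G. (f g, f h) \<in> gpairs H \<and> f (gmult G g h) = gmult H (f g) (f h))"


section \<open>Twists\<close>

abbreviation circle :: "complex set"
  where "circle \<equiv> sphere 0 1"

text \<open>The trivial group bundle $G^{(0)} \times \mathbb{T}$.\<close>

definition circle_bundle :: "'a groupoid \<Rightarrow> ('a \<times> complex) groupoid"
  where "circle_bundle G =
    \<lparr>gtop = prod_topology (unit_top G) (top_of_set circle),
     gpairs = {((u, z), (u, w)) | u z w. u \<in> units G \<and> z \<in> circle \<and> w \<in> circle},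
     gmult = (\<lambda>(u, z) (v, w). (u, z * w)),
     ginv = (\<lambda>(u, z). (u, inverse z))\<rparr>"

text \<open>
  The units of \<open>\<Sigma>\<close> are identified with those of \<open>G\<close> by the mutually inverse homeomorphisms
  \<open>j\<close> and \<open>\<lambda>u. i (u, 1)\<close>. Accordingly, the unit \<open>r(\<sigma>)\<close> in the centrality axiom, viewed as a unit
  of \<open>G\<close>, is \<open>j (gran \<Sigma> \<sigma>)\<close>, and similarly for \<open>d(\<sigma>)\<close>.
\<close>

locale twist = G: lch_groupoid G + \<Sigma>: lch_groupoid \<Sigma>
  for G :: "'a groupoid" and \<Sigma> :: "'b groupoid" +
  fixes i :: "'a \<times> complex \<Rightarrow> 'b" and j :: "'b \<Rightarrow> 'a"
  assumes hom_i: "groupoid_hom (circle_bundle G) \<Sigma> i"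
    and hom_j: "groupoid_hom \<Sigma> G j"
    and units_identified: "homeomorphic_maps (unit_top \<Sigma>) (unit_top G) j (\<lambda>u. i (u, 1))"
    and j_i: "\<lbrakk>u \<in> units G; z \<in> circle\<rbrakk> \<Longrightarrow> j (i (u, z)) = u"
    and homeo_i: "homeomorphic_map (gtop (circle_bundle G))
        (subtopology (gtop \<Sigma>) {\<sigma> \<in> arrows \<Sigma>. j \<sigma> \<in> units G}) i"
    and continuous_j: "continuous_map (gtop \<Sigma>) (gtop G) j"
    and open_j: "open_map (gtop \<Sigma>) (gtop G) j"
    and surj_j: "j ` arrows \<Sigma> = arrows G"
    and central: "\<lbrakk>\<sigma> \<in> arrows \<Sigma>; z \<in> circle\<rbrakk> \<Longrightarrow>
        gmult \<Sigma> (i (j (gran \<Sigma> \<sigma>), z)) \<sigma> = gmult \<Sigma> \<sigma> (i (j (gdom \<Sigma> \<sigma>), z))"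

definition continuous_twist :: "'a groupoid \<Rightarrow> 'b groupoid \<Rightarrow> ('b \<Rightarrow> 'a) \<Rightarrow> bool"
  where "continuous_twist G \<Sigma> j \<longleftrightarrow>
    (\<exists>s. continuous_map (gtop G) (gtop \<Sigma>) s \<and> (\<forall>g\<in>arrows G. j (s g) = g))"

end

theory Submission
  imports Defs
begin

text \<open>
  The circle acts on \<open>\<Sigma>\<close> by \<open>z \<cdot> \<sigma> = i (r(\<sigma>), z) \<sigma>\<close>. This action is free because \<open>i\<close>
  is injective, and its orbits are the fibres of \<open>j\<close> because two elements over the same arrow differ by
  an element over a unit. So \<open>j\<close> is the orbit map of a free action of a compact Lie group on a locally compact
  Hausdorff space, and such a map has local sections. For the circle this takes only an average:
  if \<open>h\<close> is a bump function at \<open>\<sigma>\<^sub>0\<close>, the first Fourier coefficient of \<open>h\<close> along the orbits,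
  \<open>F(\<sigma>) = \<integral> e\<^sup>-\<^sup>i\<^sup>t h(e\<^sup>i\<^sup>t \<cdot> \<sigma>) dt\<close>, is continuous and satisfies \<open>F(z \<cdot> \<sigma>) = z F(\<sigma>)\<close>, and it does not vanish
  at \<open>\<sigma>\<^sub>0\<close> because the bump is concentrated on the half of the orbit where \<open>z\<close> has positive real part
  (\<open>exists_equivariant_map\<close>). Rotating each \<open>\<sigma>\<close> with \<open>F(\<sigma>) \<noteq> 0\<close> until \<open>F\<close> becomes
  positive selects one point of each orbit near that of \<open>\<sigma>\<^sub>0\<close>, and as \<open>j\<close> is open this selection
  descends to a continuous section over a neighbourhood of \<open>j(\<sigma>\<^sub>0)\<close> (\<open>orbit_map_local_section\<close>).

  The local sections can be glued because \<open>G\<close> has many clopen sets. Since \<open>G\<close> is locally homeomorphic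
  to its totally disconnected unit space, it is totally disconnected itself, and a totally
  disconnected locally compact Hausdorff space has a base of clopen sets. By \<open>\<sigma>\<close>-compactness
  countably many clopen sets that carry sections cover \<open>G\<close>. Subtracting from each of them its
  predecessors gives a partition into open sets, on which the sections combine without
  any compatibility condition (\<open>global_section_if_local_sections\<close>).
\<close>

section \<open>Totally disconnected spaces\<close>

text \<open>
  A connected set is mapped into a single fibre. The fibres of a local homeomorphism are discrete,
  so each point of the set is open and closed in it.
\<close>

lemma totally_disconnected_space_local_homeomorphism:
  assumes f: "continuous_map X Y f" and lh: "local_homeomorphism_map X Y f"
    and X: "t1_space X" and Y: "totally_disconnected_space Y"
  shows "totally_disconnected_space X"
  unfolding totally_disconnected_space_def
proof (intro allI impI)
  fix S
  assume S: "connectedin X S"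
  have "connectedin Y (f ` S)"
    using connectedin_continuous_map_image f S by blast
  then obtain y where y: "f ` S \<subseteq> {y}"
    using Y by (auto simp: totally_disconnected_space_def)
  show "\<exists>x. S \<subseteq> {x}"
  proof (cases "S = {}")
    case False
    then obtain x where x: "x \<in> S" by blast
    have SX: "S \<subseteq> topspace X"
      using S connectedin_subset_topspace by blast
    with x lh obtain U where U: "openin X U" "x \<in> U"
      "homeomorphic_map (subtopology X U) (subtopology Y (f ` U)) f"
      unfolding local_homeomorphism_map_def by blast
    have "inj_on f U"
      using homeomorphic_imp_injective_map[OF U(3)] openin_subset[OF U(1)] by (simp add: inf.absorb2)
    then have SU: "S \<inter> U = {x}"
      using x U(2) y by (auto dest: inj_onD)
    have "openin (subtopology X S) {x}"
      using U(1) SU by (auto simp: openin_subtopology)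
    moreover have "closedin (subtopology X S) {x}"
      using X x SX by (auto simp: closedin_subtopology t1_space_closedin_singleton intro!: exI[of _ "{x}"])
    ultimately have "{x} = topspace (subtopology X S)"
      using S by (auto simp: connectedin_def connected_space_clopen_in)
    then show ?thesis
      using SX by (auto simp: inf.absorb2)
  qed auto
qed

text \<open>
  The component of \<open>x\<close> is \<open>{x}\<close>. In a locally compact Hausdorff space a compact component can be
  separated by a clopen set from every closed set disjoint from it.
\<close>

lemma clopen_neighbourhood:
  assumes "locally_compact_space X" "Hausdorff_space X" and td: "totally_disconnected_space X"
    and W: "openin X W" "x \<in> W"
  obtains U where "openin X U" "closedin X U" "x \<in> U" "U \<subseteq> W"
proof -
  have x: "x \<in> topspace X"
    using W openin_subset by blast
  have "connectedin X (connected_component_of_set X x)"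
    by (rule connectedin_connected_component_of)
  then obtain y where "connected_component_of_set X x \<subseteq> {y}"
    using td unfolding totally_disconnected_space_def by blast
  moreover have "x \<in> connected_component_of_set X x"
    using x by (simp add: connected_component_of_refl)
  ultimately have "connected_component_of_set X x = {x}"
    by blast
  then have "{x} \<in> connected_components_of X"
    using x by (metis connected_component_in_connected_components_of)
  moreover have "closedin X (topspace X - W)" "compactin X {x}" "disjnt {x} (topspace X - W)"
    using W x by auto
  ultimately have "separated_between X {x} (topspace X - W)"
    using assms separated_between_compact_connected_component by blast
  then obtain U where U: "closedin X U" "openin X U" "{x} \<subseteq> U" "topspace X - W \<subseteq> topspace X - U"
    unfolding separated_between by blast
  have "U \<subseteq> W"
    using U(4) openin_subset[OF U(2)] by blast
  with U show ?thesis
    by (intro that[of U]) auto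
qed

section \<open>Gluing local sections\<close>

lemma sigma_compact_imp_Lindelof_space:
  assumes "sigma_compact_space X"
  shows "Lindelof_space X"
proof -
  obtain \<K> where \<K>: "countable \<K>" "\<And>K. K \<in> \<K> \<Longrightarrow> compactin X K" "\<Union>\<K> = topspace X"
    using assms by (auto simp: sigma_compact_space_def)
  have "Lindelof_space (subtopology X (\<Union>\<K>))"
  proof (rule Lindelof_space_Union[OF \<K>(1)])
    show "Lindelof_space (subtopology X K)" if "K \<in> \<K>" for K
      using \<K>(2)[OF that] by (intro compact_imp_Lindelof_space) (simp add: compactin_subspace)
  qed
  then show ?thesis
    using \<K> by simp
qed

text \<open>
  Clopen sets that carry sections cover \<open>Y\<close>, and by the Lindelof property they can be enumerated. Then
  each of them has only finitely many predecessors, so it stays open when these are removed. On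
  the resulting disjoint pieces the local sections may be chosen independently.
\<close>

lemma global_section_if_local_sections:
  assumes Y: "Lindelof_space Y" "locally_compact_space Y" "Hausdorff_space Y"
      "totally_disconnected_space Y"
    and loc: "\<And>y. y \<in> topspace Y \<Longrightarrow> \<exists>W s. openin Y W \<and> y \<in> W \<and>
      continuous_map (subtopology Y W) X s \<and> (\<forall>v\<in>W. p (s v) = v)"
  shows "\<exists>s. continuous_map Y X s \<and> (\<forall>y\<in>topspace Y. p (s y) = y)"
proof -
  define good where "good U \<longleftrightarrow> openin Y U \<and> closedin Y U \<and>
      (\<exists>s. continuous_map (subtopology Y U) X s \<and> (\<forall>v\<in>U. p (s v) = v))" for U
  have "\<exists>U. good U \<and> y \<in> U" if y: "y \<in> topspace Y" for y
  proof -
    obtain W s where W: "openin Y W" "y \<in> W" and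
      s: "continuous_map (subtopology Y W) X s" "\<forall>v\<in>W. p (s v) = v"
      using loc[OF y] by blast
    obtain U where U: "openin Y U" "closedin Y U" "y \<in> U" "U \<subseteq> W"
      by (rule clopen_neighbourhood[OF Y(2-4) W])
    have "continuous_map (subtopology Y U) X s"
      using s(1) U(4) by (rule continuous_map_from_subtopology_mono)
    with U s(2) show ?thesis
      unfolding good_def by blast
  qed
  then have "topspace Y \<subseteq> \<Union>(Collect good)"
    by blast
  moreover have "openin Y U" if "U \<in> Collect good" for U
    using that by (simp add: good_def)
  ultimately have "\<exists>\<U>. countable \<U> \<and> \<U> \<subseteq> Collect good \<and> topspace Y \<subseteq> \<Union>\<U>"
    using Y(1) unfolding Lindelof_space_alt by simp
  then obtain \<U> where \<U>: "countable \<U>" "\<U> \<subseteq> Collect good" "topspace Y \<subseteq> \<Union>\<U>"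
    by blast
  have good_empty: "good {}"
    by (auto simp: good_def continuous_map_def)
  \<comment> \<open>The empty set is added because only a nonempty family can be enumerated; it carries the empty section.\<close>
  define V where "V = from_nat_into (insert {} \<U>)"
  have ran: "range V = insert {} \<U>"
    unfolding V_def by (rule range_from_nat_into) (simp_all add: \<U>(1))
  have V: "good (V n)" for n
  proof -
    have "V n \<in> insert {} \<U>"
      unfolding ran[symmetric] by simp
    then show ?thesis
      using \<U>(2) good_empty by auto
  qed
  then have "\<exists>s. continuous_map (subtopology Y (V n)) X s \<and> (\<forall>v\<in>V n. p (s v) = v)" for n
    unfolding good_def by blast
  then obtain s where s: "\<And>n. continuous_map (subtopology Y (V n)) X (s n)"
      "\<And>n v. v \<in> V n \<Longrightarrow> p (s n v) = v"
    by metis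
  have cover: "topspace Y \<subseteq> (\<Union>n. disjointed V n)"
    using \<U>(3) by (simp add: UN_disjointed_eq ran)
  have opn: "openin Y (disjointed V n)" for n
    unfolding disjointed_def
  proof (rule openin_diff)
    show "closedin Y (\<Union>i\<in>{0..<n}. V i)"
      using V by (intro closedin_Union) (auto simp: good_def)
  qed (use V in \<open>auto simp: good_def\<close>)
  have cont: "continuous_map (subtopology Y (disjointed V n)) X (s n)" for n
    using s(1) disjointed_subset by (rule continuous_map_from_subtopology_mono)
  have agree: "s m y = s n y" if "y \<in> topspace Y \<inter> disjointed V m \<inter> disjointed V n" for m n y
    using that disjoint_family_disjointed[of V] by (cases "m = n") (auto simp: disjoint_family_on_def)
  obtain t where t: "continuous_map Y X t"
      "\<And>y n. y \<in> topspace Y \<inter> disjointed V n \<Longrightarrow> t y = s n y"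
  proof (rule pasting_lemma_exists[of Y "disjointed V" UNIV X s])
    show "topspace Y \<subseteq> (\<Union>n\<in>UNIV. disjointed V n)" using cover by simp
  qed (use opn cont agree in simp_all)
  have "p (t y) = y" if y: "y \<in> topspace Y" for y
  proof -
    obtain n where n: "y \<in> disjointed V n"
      using cover y by blast
    then have "y \<in> V n"
      using disjointed_subset[of V n] by blast
    with t(2)[of y n] y n s(2) show ?thesis by auto
  qed
  with t(1) show ?thesis by blast
qed

section \<open>Integrals with a parameter\<close>

text \<open>
  By compactness of the interval the integrand is, over a whole neighbourhood of a parameter value,
  uniformly close to the integrand at that value (the tube lemma).
\<close>

lemma continuous_map_integral_parameter:
  fixes f :: "real \<Rightarrow> 'a \<Rightarrow> 'c::euclidean_space"
  assumes f: "continuous_map (prod_topology (top_of_set {a..b}) X) euclidean (\<lambda>(t, x). f t x)"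
  shows "continuous_map X euclidean (\<lambda>x. integral {a..b} (\<lambda>t. f t x))"
proof (cases "a \<le> b")
  case True
  have sec: "continuous_on {a..b} (\<lambda>t. f t x)" if "x \<in> topspace X" for x
  proof -
    have "continuous_map (top_of_set {a..b}) (prod_topology (top_of_set {a..b}) X) (\<lambda>t. (t, x))"
      using that by (intro continuous_map_pairedI) auto
    from continuous_map_compose[OF this f] show ?thesis
      by (simp add: o_def)
  qed
  have "\<exists>U. openin X U \<and> x \<in> U \<and>
      (\<forall>y\<in>U. integral {a..b} (\<lambda>t. f t y) \<in> ball (integral {a..b} (\<lambda>t. f t x)) e)"
    if x: "x \<in> topspace X" and e: "e > 0" for x e
  proof -
    \<comment> \<open>The summand \<open>1\<close> covers the degenerate interval and makes the final estimate strict.\<close>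
    define d where "d = e / (b - a + 1)"
    have d: "d > 0"
      using e True by (simp add: d_def)
    have "d * (b - a) < d * (b - a + 1)"
      using d by (intro mult_strict_left_mono) auto
    also have "\<dots> = e"
      using True by (simp add: d_def)
    finally have de: "d * (b - a) < e" .
    define D where "D = (\<lambda>(t, y). norm (f t y - f t x))"
    have fx: "continuous_map (prod_topology (top_of_set {a..b}) X) euclidean (\<lambda>z. f (fst z) x)"
    proof -
      have "continuous_map (top_of_set {a..b}) euclidean (\<lambda>t. f t x)"
        using sec[OF x] by simp
      from continuous_map_compose[OF continuous_map_fst this] show ?thesis
        by (simp add: o_def)
    qed
    have "continuous_map (prod_topology (top_of_set {a..b}) X) euclidean
        (\<lambda>z. (case z of (t, x) \<Rightarrow> f t x) - f (fst z) x)"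
      using f fx by (rule continuous_map_diff)
    then have "continuous_map (prod_topology (top_of_set {a..b}) X) euclideanreal D"
      unfolding D_def by (simp add: case_prod_unfold continuous_map_norm)
    then have op: "openin (prod_topology (top_of_set {a..b}) X)
        {z \<in> topspace (prod_topology (top_of_set {a..b}) X). D z \<in> {..<d}}"
      by (rule openin_continuous_map_preimage) simp
    have cpt: "compactin (top_of_set {a..b}) {a..b}"
      by (simp add: compactin_subtopology)
    have "{a..b} \<times> {x} \<subseteq> {z \<in> topspace (prod_topology (top_of_set {a..b}) X). D z \<in> {..<d}}"
      using d x by (auto simp: D_def)
    from tube_lemma_left[OF op cpt x this] obtain U V where
      UV: "openin X V" "{a..b} \<subseteq> U" "x \<in> V"
        "U \<times> V \<subseteq> {z \<in> topspace (prod_topology (top_of_set {a..b}) X). D z \<in> {..<d}}"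
      by blast
    show ?thesis
    proof (intro exI[of _ V] conjI ballI)
      fix y assume y: "y \<in> V"
      then have yX: "y \<in> topspace X"
        using UV openin_subset by blast
      have "norm (integral {a..b} (\<lambda>t. f t y - f t x)) \<le> d * (b - a)"
      proof (rule integral_bound[OF True])
        show "continuous_on {a..b} (\<lambda>t. f t y - f t x)"
          by (intro continuous_on_diff sec x yX)
        show "norm (f t y - f t x) \<le> d" if "t \<in> {a..b}" for t
        proof -
          have "(t, y) \<in> U \<times> V"
            using UV(2) that y by blast
          then have "D (t, y) < d"
            using UV(4) by blast
          then show ?thesis
            by (simp add: D_def)
        qed
      qed
      also have "integral {a..b} (\<lambda>t. f t y - f t x) =
          integral {a..b} (\<lambda>t. f t y) - integral {a..b} (\<lambda>t. f t x)"
        by (intro integral_diff integrable_continuous_real sec x yX)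
      finally show "integral {a..b} (\<lambda>t. f t y) \<in> ball (integral {a..b} (\<lambda>t. f t x)) e"
        using de by (simp add: dist_norm norm_minus_commute)
    qed (use UV in auto)
  qed
  then show ?thesis
    using Met_TC.continuous_map_to_metric[of X "\<lambda>x. integral {a..b} (\<lambda>t. f t x)"] by auto
next
  case False
  then show ?thesis by simp
qed

lemma integral_shift_periodic:
  fixes k :: "real \<Rightarrow> 'c::euclidean_space"
  assumes k: "continuous_on UNIV k" and per: "\<And>t. k (t + p) = k t" and a: "0 \<le> a" "a \<le> p"
  shows "integral {0..p} (\<lambda>t. k (t + a)) = integral {0..p} k"
proof -
  have int: "k integrable_on {c..d}" for c d
    by (rule integrable_continuous_real, rule continuous_on_subset[OF k]) auto
  have "integral {0..p} (\<lambda>t. k (t + a)) = integral {a..p + a} k"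
    using integral_shift_real_ivl[of a a "p + a" k] by simp
  also have "\<dots> = integral {a..p} k + integral {p..p + a} k"
    by (rule Henstock_Kurzweil_Integration.integral_combine[symmetric, OF _ _ int]) (use a in auto)
  also have "integral {p..p + a} k = integral {0..a} k"
    using integral_shift_real_ivl[of p p "p + a" k] per by simp
  also have "integral {a..p} k + integral {0..a} k = integral {0..p} k"
    using a Henstock_Kurzweil_Integration.integral_combine[of 0 a p k] int by (simp add: add.commute)
  finally show ?thesis .
qed

section \<open>Free actions of the circle\<close>

locale free_circle_action =
  fixes X :: "'a topology" and act :: "complex \<Rightarrow> 'a \<Rightarrow> 'a"
  assumes continuous_act:
      "continuous_map (prod_topology (top_of_set circle) X) X (\<lambda>(z, x). act z x)"
    and act_one: "x \<in> topspace X \<Longrightarrow> act 1 x = x"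
    and act_mult: "\<lbrakk>z \<in> circle; w \<in> circle; x \<in> topspace X\<rbrakk> \<Longrightarrow> act z (act w x) = act (z * w) x"
    and free: "\<lbrakk>z \<in> circle; x \<in> topspace X; act z x = x\<rbrakk> \<Longrightarrow> z = 1"
begin

lemma act_closed: "z \<in> circle \<Longrightarrow> x \<in> topspace X \<Longrightarrow> act z x \<in> topspace X"
  using continuous_act by (auto simp: continuous_map_def Pi_iff)

lemma continuous_act_comp:
  assumes "continuous_map Z (top_of_set circle) f" "continuous_map Z X g"
  shows "continuous_map Z X (\<lambda>x. act (f x) (g x))"
  using continuous_map_compose[OF continuous_map_pairedI[OF assms] continuous_act]
  by (simp add: o_def)

text \<open>
  The function \<open>F\<close> is the Fourier coefficient of frequency one, along the orbits, of a function
  \<open>h \<ge> 0\<close> on \<open>X\<close>; invariance of arc length under rotation makes it equivariant. To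
  keep it from vanishing at \<open>x0\<close>, \<open>h\<close> is chosen zero on the half orbit of all \<open>act z x0\<close> with
  \<open>Re z \<le> 0\<close>. By freeness that half does not contain \<open>x0\<close> itself, so \<open>h x0 = 1\<close> can be
  achieved as well. The real part of the integrand at \<open>x0\<close> is then \<open>cos t * h (act (cis t) x0) \<ge> 0\<close>,
  because the second factor vanishes whenever \<open>cos t \<le> 0\<close>, and it equals \<open>1\<close> at \<open>t = 0\<close>; so
  the integral is positive.
\<close>

lemma exists_equivariant_map:
  assumes "completely_regular_space X" "Hausdorff_space X" and x0: "x0 \<in> topspace X"
  obtains F where "continuous_map X euclidean F" "F x0 \<noteq> 0"
    "\<And>z x. \<lbrakk>z \<in> circle; x \<in> topspace X\<rbrakk> \<Longrightarrow> F (act z x) = z * F x"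
proof -
  define S where "S = (\<lambda>z. act z x0) ` {z \<in> circle. Re z \<le> 0}"
  have cs: "compact {z \<in> circle. Re z \<le> 0}"
  proof -
    have "{z \<in> circle. Re z \<le> 0} = circle \<inter> {z. Re z \<le> 0}" by auto
    then show ?thesis
      by (simp add: compact_Int_closed closed_halfspace_Re_le)
  qed
  have "compactin X S"
    unfolding S_def
  proof (rule image_compactin)
    show "compactin (top_of_set circle) {z \<in> circle. Re z \<le> 0}"
      using cs by (auto simp: compactin_subtopology)
    show "continuous_map (top_of_set circle) X (\<lambda>z. act z x0)"
      using x0 by (intro continuous_act_comp) (auto simp: continuous_map_in_subtopology)
  qed
  then have "closedin X S"
    using assms(2) by (rule compactin_imp_closedin[rotated])
  moreover have "x0 \<notin> S"
  proof
    assume "x0 \<in> S"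
    then obtain z where "z \<in> circle" "Re z \<le> 0" "act z x0 = x0"
      unfolding S_def by auto
    with free[of z x0] x0 show False by auto
  qed
  ultimately obtain h0 :: "'a \<Rightarrow> real" where h0: "continuous_map X (top_of_set {0..1}) h0" "h0 x0 = 0"
      "h0 ` S \<subseteq> {1}"
    using assms(1) x0 unfolding completely_regular_space_def by (metis DiffI)
  define h where "h x = 1 - h0 x" for x
  have h: "continuous_map X euclidean (\<lambda>x. complex_of_real (h x))"
  proof -
    have h0': "continuous_map X euclideanreal h0"
      using h0(1) by (simp add: continuous_map_in_subtopology)
    have "continuous_map euclideanreal euclidean (\<lambda>r. complex_of_real (1 - r))"
      by (auto intro!: continuous_intros)
    from continuous_map_compose[OF h0' this] show ?thesis
      by (simp add: o_def h_def)
  qed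
  have h_nonneg: "h x \<ge> 0" if "x \<in> topspace X" for x
    using h0(1) that by (auto simp: h_def continuous_map_in_subtopology Pi_iff)
  have h_x0: "h x0 = 1" and h_S: "\<And>x. x \<in> S \<Longrightarrow> h x = 0"
    using h0(2,3) by (auto simp: h_def)
  define k where "k x t = cis (- t) * of_real (h (act (cis t) x))" for x t
  have k_joint: "continuous_map (prod_topology (top_of_set T) X) euclidean (\<lambda>(t, x). k x t)" for T
  proof -
    let ?Z = "prod_topology (top_of_set T) X"
    have fst: "continuous_map ?Z euclidean (\<lambda>p. g (fst p))"
      if "continuous_on UNIV g" for g :: "real \<Rightarrow> complex"
    proof -
      have "continuous_map (top_of_set T) euclidean g"
        using that continuous_on_subset by auto
      from continuous_map_compose[OF continuous_map_fst this] show ?thesis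
        by (simp add: o_def)
    qed
    have "continuous_map ?Z (top_of_set circle) (\<lambda>p. cis (fst p))"
      unfolding continuous_map_in_subtopology
      by (intro conjI fst) (auto intro!: continuous_intros)
    then have "continuous_map ?Z X (\<lambda>p. act (cis (fst p)) (snd p))"
      by (intro continuous_act_comp continuous_map_snd)
    from continuous_map_compose[OF this h]
    have "continuous_map ?Z euclidean (\<lambda>p. complex_of_real (h (act (cis (fst p)) (snd p))))"
      by (simp add: o_def)
    moreover have "continuous_map ?Z euclidean (\<lambda>p. cis (- fst p))"
      by (rule fst) (auto intro!: continuous_intros)
    ultimately show ?thesis
      unfolding k_def case_prod_unfold
      by (simp add: continuous_map_atin tendsto_mult)
  qed
  have k_cont: "continuous_on T (k x)" if "x \<in> topspace X" for x T
  proof -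
    have "continuous_map (top_of_set T) (prod_topology (top_of_set T) X) (\<lambda>t. (t, x))"
      using that by (intro continuous_map_pairedI) auto
    from continuous_map_compose[OF this k_joint] show ?thesis
      by (simp add: o_def)
  qed
  define F where "F x = integral {0..2 * pi} (k x)" for x
  show ?thesis
  proof
    show "continuous_map X euclidean F"
      unfolding F_def using k_joint by (rule continuous_map_integral_parameter)
    show "F (act z x) = z * F x" if z: "z \<in> circle" and x: "x \<in> topspace X" for z x
    proof -
      define a where "a = Arg2pi z"
      have a: "0 \<le> a" "a \<le> 2 * pi" and za: "z = cis a"
        using Arg2pi[of z] z by (auto simp: a_def cis_conv_exp is_Arg_def)
      have shift: "k (act z x) t = z * k x (t + a)" for t
      proof -
        have "act (cis t) (act z x) = act (cis (t + a)) x"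
          using x by (simp add: za act_mult cis_mult)
        moreover have "cis (- t) = z * cis (- (t + a))"
          by (simp add: za cis_mult)
        ultimately show ?thesis
          by (simp add: k_def)
      qed
      then have "k (act z x) = (\<lambda>t. z * k x (t + a))"
        by (rule ext)
      then have "F (act z x) = integral {0..2 * pi} (\<lambda>t. z * k x (t + a))"
        by (simp add: F_def)
      also have "\<dots> = z * integral {0..2 * pi} (\<lambda>t. k x (t + a))"
        by simp
      also have "integral {0..2 * pi} (\<lambda>t. k x (t + a)) = F x"
        unfolding F_def
      proof (rule integral_shift_periodic[OF k_cont[OF x] _ a])
        show "k x (t + 2 * pi) = k x t" for t
        proof -
          have "cis (t + 2 * pi) = cis t"
            by (simp flip: cis_mult)
          then show ?thesis
            by (simp only: k_def cis_cnj[symmetric])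
        qed
      qed
      finally show ?thesis .
    qed
    show "F x0 \<noteq> 0"
    proof
      assume "F x0 = 0"
      have Re_k: "Re (k x0 t) = cos t * h (act (cis t) x0)" for t
        by (simp add: k_def)
      have "k x0 integrable_on {0..2 * pi}"
        using k_cont[OF x0] by (rule integrable_continuous_real)
      then have "integral {0..2 * pi} (\<lambda>t. Re (k x0 t)) = Re (F x0)"
        unfolding F_def by (rule integral_linear[OF _ bounded_linear_Re, unfolded o_def])
      also have "\<dots> = 0" using \<open>F x0 = 0\<close> by simp
      finally have "\<forall>t\<in>{0..2 * pi}. Re (k x0 t) = 0"
      proof (subst (asm) integral_eq_0_iff)
        show "continuous_on {0..2 * pi} (\<lambda>t. Re (k x0 t))"
          by (intro continuous_intros k_cont x0)
        show "0 \<le> Re (k x0 t)" for t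
        proof (cases "cos t \<le> 0")
          case True
          then have "act (cis t) x0 \<in> S"
            unfolding S_def by (intro imageI) simp
          then show ?thesis
            by (simp add: Re_k h_S)
        next
          case False
          then show ?thesis
            using h_nonneg[OF act_closed[OF _ x0, of "cis t"]] by (simp add: Re_k)
        qed
      qed auto
      then have "Re (k x0 0) = 0"
        by auto
      then show False
        using x0 by (simp add: k_def act_one h_x0)
    qed
  qed
qed

text \<open>
  Multiplication by the conjugate phase of \<open>F x\<close> moves \<open>x\<close> to the unique point of its orbit at which
  \<open>F\<close> is positive. The resulting map is constant on fibres of \<open>p\<close> and therefore factors
  through \<open>p\<close>, which is a quotient map on the open set where \<open>F\<close> does not vanish.
\<close>

lemma orbit_map_local_section:
  assumes X: "completely_regular_space X" "Hausdorff_space X" and x0: "x0 \<in> topspace X"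
    and p: "continuous_map X Y p" "open_map X Y p"
    and p_act: "\<And>z x. \<lbrakk>z \<in> circle; x \<in> topspace X\<rbrakk> \<Longrightarrow> p (act z x) = p x"
    and fibre: "\<And>x y. \<lbrakk>x \<in> topspace X; y \<in> topspace X; p x = p y\<rbrakk> \<Longrightarrow> \<exists>z\<in>circle. y = act z x"
  shows "\<exists>W s. openin Y W \<and> p x0 \<in> W \<and>
      continuous_map (subtopology Y W) X s \<and> (\<forall>v\<in>W. p (s v) = v)"
proof -
  obtain F where F: "continuous_map X euclidean F" "F x0 \<noteq> 0"
    "\<And>z x. \<lbrakk>z \<in> circle; x \<in> topspace X\<rbrakk> \<Longrightarrow> F (act z x) = z * F x"
    using exists_equivariant_map[OF X x0] by blast
  define U where "U = {x \<in> topspace X. F x \<in> - {0}}"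
  have U: "openin X U"
    unfolding U_def using F(1) by (rule openin_continuous_map_preimage) auto
  have UX: "U \<subseteq> topspace X"
    unfolding U_def by blast
  then have topU: "topspace (subtopology X U) = U"
    by auto
  define c where "c x = cnj (F x) / of_real (norm (F x))" for x
  have c_circle: "c x \<in> circle" if "x \<in> U" for x
    using that by (simp add: c_def U_def norm_divide)
  define q where "q x = act (c x) x" for x
  have FU: "continuous_map (subtopology X U) (top_of_set (- {0})) F"
    using F(1) by (auto simp: continuous_map_in_subtopology continuous_map_from_subtopology U_def)
  have "continuous_map (top_of_set (- {0})) euclidean (\<lambda>w. cnj w / of_real (norm w))"
    by (auto intro!: continuous_intros)
  from continuous_map_compose[OF FU this]
  have "continuous_map (subtopology X U) euclidean c"
    unfolding c_def by (simp add: o_def)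
  then have "continuous_map (subtopology X U) (top_of_set circle) c"
    using c_circle topU by (auto simp: continuous_map_in_subtopology)
  then have q: "continuous_map (subtopology X U) X q"
    unfolding q_def by (rule continuous_act_comp) (simp add: continuous_map_from_subtopology)
  have q_fibre: "q x = q y" if xy: "x \<in> U" "y \<in> U" "p x = p y" for x y
  proof -
    obtain z where z: "z \<in> circle" "y = act z x"
      using fibre xy UX by blast
    have zz: "z * cnj z = 1"
      using z(1) by (simp add: complex_norm_square[symmetric])
    have Fy: "F y = z * F x"
      using z xy UX F(3) by blast
    have "c y * z = (z * cnj z) * c x"
      using z(1) by (simp add: c_def Fy norm_mult)
    then have "c y * z = c x"
      by (simp add: zz)
    then show ?thesis
      using c_circle[OF xy(2)] z xy UX by (simp add: q_def act_mult subset_iff)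
  qed
  have quot: "quotient_map (subtopology X U) (subtopology Y (p ` U)) p"
  proof (rule continuous_open_imp_quotient_map)
    show "continuous_map (subtopology X U) (subtopology Y (p ` U)) p"
      using p(1) topU by (auto simp: continuous_map_in_subtopology continuous_map_from_subtopology)
    show "open_map (subtopology X U) (subtopology Y (p ` U)) p"
      using open_map_from_subtopology[OF p(2) U] topU
      by (auto simp: open_map_into_subtopology)
    show "p ` topspace (subtopology X U) = topspace (subtopology Y (p ` U))"
      using p(1) UX topU by (auto simp: continuous_map_def Pi_iff)
  qed
  obtain s where s: "continuous_map (subtopology Y (p ` U)) X s"
      "\<And>x. x \<in> U \<Longrightarrow> s (p x) = q x"
    using quotient_map_lift_exists[OF quot q] q_fibre topU by metis
  have "p (q x) = p x" if "x \<in> U" for x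
    using that c_circle UX p_act by (auto simp: q_def)
  moreover have "openin Y (p ` U)"
    using p(2) U by (simp add: open_map_def)
  moreover have "x0 \<in> U"
    using x0 F(2) by (simp add: U_def)
  ultimately show ?thesis
    using s by (intro exI[of _ "p ` U"] exI[of _ s]) auto
qed

end

section \<open>Groupoids\<close>

context topological_groupoid
begin

lemma gpairs_ginv_right: "g \<in> arrows G \<Longrightarrow> (g, ginv G g) \<in> gpairs G"
  using gpairs_ginv[OF ginv_closed] by (simp add: ginv_ginv)

lemma gran_eq_gdom_ginv: "g \<in> arrows G \<Longrightarrow> gran G g = gdom G (ginv G g)"
  by (simp add: gran_def gdom_def ginv_ginv)

lemma gdom_in_units: "g \<in> arrows G \<Longrightarrow> gdom G g \<in> units G"
  by (simp add: units_def)

lemma gran_in_units: "g \<in> arrows G \<Longrightarrow> gran G g \<in> units G"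
  by (simp add: gran_eq_gdom_ginv gdom_in_units ginv_closed)

lemma gdom_closed: "g \<in> arrows G \<Longrightarrow> gdom G g \<in> arrows G"
  unfolding gdom_def by (intro gmult_closed gpairs_ginv)

lemma units_subset_arrows: "units G \<subseteq> arrows G"
  by (auto simp: units_def gdom_closed)

lemma topspace_unit_top: "topspace (unit_top G) = units G"
  using units_subset_arrows by (auto simp: unit_top_def arrows_def)

lemma gpairs_gran: "g \<in> arrows G \<Longrightarrow> (gran G g, g) \<in> gpairs G"
  unfolding gran_def by (rule gpairs_mult_left[OF gpairs_ginv_right gpairs_ginv])

lemma gran_mult: "g \<in> arrows G \<Longrightarrow> gmult G (gran G g) g = g"
  using ginv_cancel_left[OF gpairs_ginv, of g] gmult_assoc[OF gpairs_ginv_right gpairs_ginv, of g]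
  by (simp add: gran_def ginv_ginv)

lemma mult_gdom: "g \<in> arrows G \<Longrightarrow> gmult G g (gdom G g) = g"
  using ginv_cancel_left[OF gpairs_ginv, of g] by (simp add: gdom_def ginv_ginv)

lemma gpairs_ginv_if_gdom_eq:
  assumes "g \<in> arrows G" "h \<in> arrows G" "gdom G g = gdom G h"
  shows "(g, ginv G h) \<in> gpairs G"
proof -
  have "(g, gdom G g) \<in> gpairs G"
    unfolding gdom_def using assms(1) by (intro gpairs_mult_right gpairs_ginv_right gpairs_ginv)
  moreover have "(gdom G g, ginv G h) \<in> gpairs G"
    unfolding assms(3) unfolding gdom_def
    using assms(2) by (intro gpairs_mult_left gpairs_ginv_right gpairs_ginv)
  ultimately have "(gmult G g (gdom G g), ginv G h) \<in> gpairs G"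
    by (rule gpairs_mult_left)
  then show ?thesis
    using assms(1) by (simp add: mult_gdom)
qed

lemma continuous_gmult_comp:
  assumes "continuous_map Z (gtop G) f" "continuous_map Z (gtop G) g"
    and "\<And>x. x \<in> topspace Z \<Longrightarrow> (f x, g x) \<in> gpairs G"
  shows "continuous_map Z (gtop G) (\<lambda>x. gmult G (f x) (g x))"
proof -
  have "continuous_map Z (subtopology (prod_topology (gtop G) (gtop G)) (gpairs G)) (\<lambda>x. (f x, g x))"
    using assms by (intro continuous_map_into_subtopology continuous_map_pairedI) auto
  from continuous_map_compose[OF this continuous_gmult] show ?thesis
    by (simp add: o_def)
qed

lemma continuous_gdom: "continuous_map (gtop G) (unit_top G) (gdom G)"
  unfolding unit_top_def gdom_def[abs_def]
proof (rule continuous_map_into_subtopology)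
  show "continuous_map (gtop G) (gtop G) (\<lambda>g. gmult G (ginv G g) g)"
    using continuous_ginv gpairs_ginv
    by (intro continuous_gmult_comp) (auto simp: arrows_def)
qed (auto simp: units_def gdom_def arrows_def)

lemma continuous_gran: "continuous_map (gtop G) (unit_top G) (gran G)"
proof -
  have "continuous_map (gtop G) (unit_top G) (gdom G \<circ> ginv G)"
    by (rule continuous_map_compose[OF continuous_ginv continuous_gdom])
  then show ?thesis
    by (rule continuous_map_eq) (simp add: gran_eq_gdom_ginv arrows_def)
qed

end

text \<open>
  The images \<open>a\<close> of \<open>g\<^sup>-\<^sup>1\<close> and \<open>b\<close> of \<open>g\<close> satisfy \<open>a b a = a\<close>. Cancelling \<open>a\<close> on the left and on the right
  gives \<open>b = a\<^sup>-\<^sup>1\<close>.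
\<close>

lemma groupoid_hom_ginv:
  assumes "topological_groupoid G" "topological_groupoid H" "groupoid_hom G H f"
    and g: "g \<in> arrows G"
  shows "f (ginv G g) = ginv H (f g)"
proof -
  interpret G: topological_groupoid G by fact
  interpret H: topological_groupoid H by fact
  define a b where "a = f (ginv G g)" and "b = f g"
  have ab: "a \<in> arrows H" "b \<in> arrows H"
    using assms g G.ginv_closed by (auto simp: groupoid_hom_def a_def b_def)
  have hom: "(f x, f y) \<in> gpairs H" "f (gmult G x y) = gmult H (f x) (f y)" if "(x, y) \<in> gpairs G" for x y
    using assms(3) that unfolding groupoid_hom_def by auto
  have pairs: "(a, b) \<in> gpairs H" "(b, a) \<in> gpairs H"
    using hom(1) G.gpairs_ginv G.gpairs_ginv_right g by (auto simp: a_def b_def)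
  have "gmult G (ginv G g) (gmult G g (ginv G g)) = ginv G g"
    using G.ginv_cancel_left[OF G.gpairs_ginv_right[OF g]] .
  then have aba: "gmult H a (gmult H b a) = a"
    using hom(2)[OF G.gpairs_ginv_right[OF g]]
      hom(2)[OF G.gpairs_mult_right[OF G.gpairs_ginv[OF g] G.gpairs_ginv_right[OF g]]]
    by (simp add: a_def b_def)
  have "gmult H b a = gmult H (ginv H a) a"
    using H.ginv_cancel_left[OF H.gpairs_mult_right[OF pairs]] by (simp add: aba)
  then have "b = gmult H (gmult H (ginv H a) a) (ginv H a)"
    using H.ginv_cancel_right[OF pairs(2)] by simp
  also have "\<dots> = ginv H a"
    using H.ginv_cancel_right[OF H.gpairs_ginv[OF ab(1)]] by simp
  finally show ?thesis
    using ab by (simp add: a_def b_def H.ginv_ginv)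
qed

section \<open>The circle action of a twist\<close>

definition (in twist) act :: "complex \<Rightarrow> 'b \<Rightarrow> 'b"
  where "act z \<sigma> = gmult \<Sigma> (i (gran G (j \<sigma>), z)) \<sigma>"

context twist
begin

lemma j_closed: "\<sigma> \<in> arrows \<Sigma> \<Longrightarrow> j \<sigma> \<in> arrows G"
  using hom_j by (auto simp: groupoid_hom_def)

lemma j_gmult: "(\<sigma>, \<tau>) \<in> gpairs \<Sigma> \<Longrightarrow> j (gmult \<Sigma> \<sigma> \<tau>) = gmult G (j \<sigma>) (j \<tau>)"
  using hom_j by (auto simp: groupoid_hom_def)

lemma j_ginv: "\<sigma> \<in> arrows \<Sigma> \<Longrightarrow> j (ginv \<Sigma> \<sigma>) = ginv G (j \<sigma>)"
  using hom_j by (intro groupoid_hom_ginv G.topological_groupoid_axioms \<Sigma>.topological_groupoid_axioms)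

lemma j_gran: "\<sigma> \<in> arrows \<Sigma> \<Longrightarrow> j (gran \<Sigma> \<sigma>) = gran G (j \<sigma>)"
  by (simp add: gran_def j_gmult j_ginv \<Sigma>.gpairs_ginv_right)

lemma j_gdom: "\<sigma> \<in> arrows \<Sigma> \<Longrightarrow> j (gdom \<Sigma> \<sigma>) = gdom G (j \<sigma>)"
  by (simp add: gdom_def j_gmult j_ginv \<Sigma>.gpairs_ginv)

lemma i_j_unit: "\<epsilon> \<in> units \<Sigma> \<Longrightarrow> i (j \<epsilon>, 1) = \<epsilon>"
  using units_identified by (auto simp: homeomorphic_maps_def \<Sigma>.topspace_unit_top)

lemma i_one: "\<sigma> \<in> arrows \<Sigma> \<Longrightarrow> i (gran G (j \<sigma>), 1) = gran \<Sigma> \<sigma>"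
  using i_j_unit[OF \<Sigma>.gran_in_units] by (simp add: j_gran)

lemma i_mult:
  assumes "u \<in> units G" "z \<in> circle" "w \<in> circle"
  shows "(i (u, z), i (u, w)) \<in> gpairs \<Sigma>" "gmult \<Sigma> (i (u, z)) (i (u, w)) = i (u, z * w)"
proof -
  have "((u, z), (u, w)) \<in> gpairs (circle_bundle G)"
    using assms by (auto simp: circle_bundle_def)
  then have "(i (u, z), i (u, w)) \<in> gpairs \<Sigma> \<and>
      i (gmult (circle_bundle G) (u, z) (u, w)) = gmult \<Sigma> (i (u, z)) (i (u, w))"
    using hom_i unfolding groupoid_hom_def by blast
  then show "(i (u, z), i (u, w)) \<in> gpairs \<Sigma>" "gmult \<Sigma> (i (u, z)) (i (u, w)) = i (u, z * w)"
    by (auto simp: circle_bundle_def)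
qed

lemma topspace_circle_bundle: "topspace (gtop (circle_bundle G)) = units G \<times> circle"
  by (simp add: circle_bundle_def G.topspace_unit_top)

lemma i_inj: "inj_on i (units G \<times> circle)"
  using homeomorphic_imp_injective_map[OF homeo_i] by (simp add: topspace_circle_bundle)

lemma i_image: "i ` (units G \<times> circle) = {\<sigma> \<in> arrows \<Sigma>. j \<sigma> \<in> units G}"
proof -
  have "{\<sigma> \<in> arrows \<Sigma>. j \<sigma> \<in> units G} \<subseteq> topspace (gtop \<Sigma>)"
    by (auto simp: arrows_def)
  then show ?thesis
    using homeomorphic_imp_surjective_map[OF homeo_i] by (simp add: topspace_circle_bundle inf.absorb2)
qed

lemma continuous_i: "continuous_map (prod_topology (unit_top G) (top_of_set circle)) (gtop \<Sigma>) i"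
  using homeomorphic_imp_continuous_map[OF homeo_i]
  by (simp add: circle_bundle_def continuous_map_in_subtopology)

text \<open>
  Since \<open>i (r(\<sigma>), z) = i (r(\<sigma>), z) i (r(\<sigma>), 1)\<close> and \<open>i (r(\<sigma>), 1)\<close> is the range of \<open>\<sigma>\<close>,
  composability with \<open>\<sigma>\<close> is inherited from the range.
\<close>

lemma gpairs_i:
  assumes "\<sigma> \<in> arrows \<Sigma>" "z \<in> circle"
  shows "(i (gran G (j \<sigma>), z), \<sigma>) \<in> gpairs \<Sigma>"
proof -
  let ?u = "gran G (j \<sigma>)"
  have u: "?u \<in> units G"
    using assms by (intro G.gran_in_units j_closed)
  have "(i (?u, z), gran \<Sigma> \<sigma>) \<in> gpairs \<Sigma>" "gmult \<Sigma> (i (?u, z)) (gran \<Sigma> \<sigma>) = i (?u, z)"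
    using i_mult[OF u assms(2), of 1] i_one[OF assms(1)] by auto
  then show ?thesis
    using \<Sigma>.gpairs_mult_left[OF _ \<Sigma>.gpairs_gran[OF assms(1)]] by fastforce
qed

lemma j_act:
  assumes "\<sigma> \<in> arrows \<Sigma>" "z \<in> circle"
  shows "j (act z \<sigma>) = j \<sigma>"
  using assms by (simp add: act_def j_gmult gpairs_i j_i G.gran_in_units j_closed G.gran_mult)

text \<open>
  If \<open>\<sigma>\<close> and \<open>\<tau>\<close> lie over the same arrow, they have the same domain, and \<open>\<tau> \<sigma>\<^sup>-\<^sup>1\<close> lies over a unit.
  By exactness of the extension it comes from the circle bundle.
\<close>

lemma act_transitive:
  assumes \<sigma>: "\<sigma> \<in> arrows \<Sigma>" and \<tau>: "\<tau> \<in> arrows \<Sigma>" and eq: "j \<sigma> = j \<tau>"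
  shows "\<exists>z\<in>circle. \<tau> = act z \<sigma>"
proof -
  have "j (gdom \<Sigma> \<tau>) = j (gdom \<Sigma> \<sigma>)"
    using assms by (simp add: j_gdom)
  then have "gdom \<Sigma> \<tau> = gdom \<Sigma> \<sigma>"
    using i_j_unit \<Sigma>.gdom_in_units \<sigma> \<tau> by metis
  then have pair: "(\<tau>, ginv \<Sigma> \<sigma>) \<in> gpairs \<Sigma>"
    using \<sigma> \<tau> by (intro \<Sigma>.gpairs_ginv_if_gdom_eq)
  define \<kappa> where "\<kappa> = gmult \<Sigma> \<tau> (ginv \<Sigma> \<sigma>)"
  have j\<kappa>: "j \<kappa> = gran G (j \<sigma>)"
    using pair \<sigma> eq by (simp add: \<kappa>_def j_gmult j_ginv gran_def)
  have "\<kappa> \<in> {\<sigma> \<in> arrows \<Sigma>. j \<sigma> \<in> units G}"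
    using pair \<sigma> by (simp add: j\<kappa> G.gran_in_units j_closed) (simp add: \<kappa>_def \<Sigma>.gmult_closed)
  then obtain u z where uz: "u \<in> units G" "z \<in> circle" "\<kappa> = i (u, z)"
    unfolding i_image[symmetric] by blast
  then have "u = gran G (j \<sigma>)"
    using j\<kappa> j_i by simp
  moreover have "gmult \<Sigma> \<kappa> \<sigma> = \<tau>"
    using \<Sigma>.ginv_cancel_right[OF pair] \<sigma> by (simp add: \<kappa>_def \<Sigma>.ginv_ginv)
  ultimately show ?thesis
    using uz by (auto simp: act_def)
qed

text \<open>
  The identity and composition laws hold because \<open>z \<mapsto> i (u, z)\<close> is multiplicative. If
  \<open>z\<close> fixes \<open>\<sigma>\<close>, cancelling \<open>\<sigma>\<close> turns \<open>i (r(\<sigma>), z)\<close> into a unit of \<open>\<Sigma>\<close>, that is, into \<open>i (r(\<sigma>), 1)\<close>.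
\<close>

lemma free_circle_action: "free_circle_action (gtop \<Sigma>) act"
proof
  let ?Z = "prod_topology (top_of_set circle) (gtop \<Sigma>)"
  have "continuous_map ?Z (unit_top G) (\<lambda>p. gran G (j (snd p)))"
    using continuous_map_compose[OF continuous_map_compose[OF continuous_map_snd continuous_j]
        G.continuous_gran] by (simp add: o_def)
  from continuous_map_compose[OF continuous_map_pairedI[OF this continuous_map_fst] continuous_i]
  have "continuous_map ?Z (gtop \<Sigma>) (\<lambda>p. i (gran G (j (snd p)), fst p))"
    by (simp add: o_def)
  then show "continuous_map ?Z (gtop \<Sigma>) (\<lambda>(z, \<sigma>). act z \<sigma>)"
    unfolding act_def case_prod_unfold
    by (intro \<Sigma>.continuous_gmult_comp continuous_map_snd) (auto intro!: gpairs_i simp: arrows_def)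
next
  fix \<sigma> assume "\<sigma> \<in> topspace (gtop \<Sigma>)"
  then have "\<sigma> \<in> arrows \<Sigma>" by (simp add: arrows_def)
  then show "act 1 \<sigma> = \<sigma>"
    by (simp add: act_def i_one \<Sigma>.gran_mult)
next
  fix z w \<sigma> assume zw: "z \<in> circle" "w \<in> circle" and "\<sigma> \<in> topspace (gtop \<Sigma>)"
  then have \<sigma>: "\<sigma> \<in> arrows \<Sigma>" by (simp add: arrows_def)
  have u: "gran G (j \<sigma>) \<in> units G"
    using \<sigma> by (intro G.gran_in_units j_closed)
  have "act z (act w \<sigma>) = gmult \<Sigma> (i (gran G (j \<sigma>), z)) (act w \<sigma>)"
    using \<sigma> zw by (simp add: act_def[of z] j_act)
  also have "\<dots> = act (z * w) \<sigma>"
    using \<Sigma>.gmult_assoc[OF i_mult(1)[OF u zw] gpairs_i[OF \<sigma> zw(2)]] i_mult(2)[OF u zw]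
    by (simp add: act_def)
  finally show "act z (act w \<sigma>) = act (z * w) \<sigma>" .
next
  fix z \<sigma> assume z: "z \<in> circle" and "\<sigma> \<in> topspace (gtop \<Sigma>)" and fixed: "act z \<sigma> = \<sigma>"
  then have \<sigma>: "\<sigma> \<in> arrows \<Sigma>" by (simp add: arrows_def)
  let ?u = "gran G (j \<sigma>)"
  have u: "?u \<in> units G"
    using \<sigma> by (intro G.gran_in_units j_closed)
  have "i (?u, z) = gran \<Sigma> \<sigma>"
    using \<Sigma>.ginv_cancel_right[OF gpairs_i[OF \<sigma> z]] fixed by (simp add: act_def gran_def)
  then have "i (?u, z) = i (?u, 1)"
    using \<sigma> by (simp add: i_one)
  then show "z = 1"
    using inj_onD[OF i_inj, of "(?u, z)" "(?u, 1)"] u z by simp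
qed

lemma local_section:
  assumes "g \<in> arrows G"
  shows "\<exists>W s. openin (gtop G) W \<and> g \<in> W \<and>
      continuous_map (subtopology (gtop G) W) (gtop \<Sigma>) s \<and> (\<forall>h\<in>W. j (s h) = h)"
proof -
  interpret A: free_circle_action "gtop \<Sigma>" act
    by (rule free_circle_action)
  obtain \<sigma> where \<sigma>: "\<sigma> \<in> topspace (gtop \<Sigma>)" "j \<sigma> = g"
    using assms surj_j unfolding arrows_def by (metis imageE)
  have "completely_regular_space (gtop \<Sigma>)"
    using \<Sigma>.locally_compact \<Sigma>.Hausdorff
    by (intro locally_compact_regular_imp_completely_regular_space) auto
  then show ?thesis
    using A.orbit_map_local_section[OF _ \<Sigma>.Hausdorff \<sigma>(1) continuous_j open_j]
      j_act act_transitive \<sigma>(2) by (simp add: arrows_def)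
qed

end

section \<open>Twists over ample groupoids\<close>

lemma (in ample_groupoid) totally_disconnected_gtop: "totally_disconnected_space (gtop G)"
  using continuous_gdom dom_local_homeomorphism Hausdorff_imp_t1_space[OF Hausdorff]
    units_totally_disconnected
  by (rule totally_disconnected_space_local_homeomorphism)

theorem corollary3p5:
  fixes G :: "'a groupoid" and \<Sigma> :: "'b groupoid"
    and i :: "'a \<times> complex \<Rightarrow> 'b" and j :: "'b \<Rightarrow> 'a"
  assumes "ample_groupoid G"
    and "sigma_compact_space (gtop G)"
    and "twist G \<Sigma> i j"
  shows "continuous_twist G \<Sigma> j"
proof -
  interpret G: ample_groupoid G by fact
  interpret twist G \<Sigma> i j by fact
  have "\<exists>s. continuous_map (gtop G) (gtop \<Sigma>) s \<and> (\<forall>g\<in>topspace (gtop G). j (s g) = g)"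
    using sigma_compact_imp_Lindelof_space[OF assms(2)] G.locally_compact G.Hausdorff
      G.totally_disconnected_gtop
  proof (rule global_section_if_local_sections)
    show "\<exists>W s. openin (gtop G) W \<and> g \<in> W \<and>
        continuous_map (subtopology (gtop G) W) (gtop \<Sigma>) s \<and> (\<forall>h\<in>W. j (s h) = h)"
      if "g \<in> topspace (gtop G)" for g
      using local_section that by (simp add: arrows_def)
  qed
  then show ?thesis
    by (simp add: continuous_twist_def arrows_def)
qed

end
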